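(* Let $q\ge 2$ and $d=2q-3$, let $I$ be a parity class of $Q_d$ with complementary parity class $D$, and let $c$ be an extremal pair-defensive $q$-colouring of $Q_d$ with attacked parity $I$. Then the following hold. (a) For $b\in D$ define $\psi(b)=b+e_{\delta(b)}$. Then $\psi:D\to I$ is a bijection. Thus the defect edges $b\psi(b)$, $b\in D$, form a perfect matching between the two parity classes. (b) For $x\in I$ define $\delta(x)=\delta(\psi^{-1}(x))$ and $$\Lambda_x=\bigl\{\{j,\ell\}\subseteq[d]: j\ne\ell\text{ and }c(x+e_j)=c(x+e_\ell)\bigr\}.$$ Then $\Lambda_x$ is a perfect matching of $[d]\setminus\{\delta(x)\}$. (c) Adjoin one auxiliary coordinate $*\notin[d]$. For each $v\in V(Q_d)$ define $$\Pi_v^+=\begin{cases}L_v\cup\{\{\delta(v),*\}\}, & v\in D,\\ \Lambda_v\cup\{\{\delta(v),*\}\}, & v\in I.\end{cases}$$ Then $\Pi_v^+$ is a perfect matching of the enlarged coordinate set $[d]\cup\{*\}$. Let $\pi_v(j)$ denote the mate of $j$ in this matching. Then, for every $v\in\mathbb F_2^d$ and every $j\in[d]$, $$\pi_{v+e_j}(j)=\pi_v(j).$$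
   Context: The hypercube $Q_d$ is the graph on $\mathbb F_2^d$ in which two vertices are adjacent when they differ in exactly one coordinate; $e_j$ is the $j$th standard basis vector, and $[n]=\{1,\dots,n\}$. Its two parity classes are the vectors of even Hamming weight and those of odd Hamming weight; $I$ is one of them (the attacked parity) and $D$ the other (the defender parity). $N(x)$ is the open neighbourhood in $Q_d$ and $N[x]=N(x)\cup\{x\}$. A pair-defensive $q$-colouring with attacked parity $I$ (an $(I,2,q)$-defensive silver colouring) is a surjective proper colouring $c:V(Q_d)\to[q]$, with colour classes $C_i=c^{-1}(i)$, such that for every colour $i\in[q]$ and every $S\subseteq I$ with $|S|\le 2$ there is an injective map $f:S\to C_i$ with $f(x)\in N[x]$ for all $x\in S$. Such a colouring is called extremal if it attains the bound $q=\lfloor (d+3)/2\rfloor$ on the number of colours; for $d=2q-3$ this means simply that it uses $q$ colours. For $b\in D$, the link of $b$ (in the set of vertices of $D$ having the same colour as $b$) is $L_b=\{\{j,\ell\}\subseteq[d]: j\ne\ell,\ c(b+e_j+e_\ell)=c(b)\}$. For extremal colourings of $Q_{2q-3}$ each $L_b$ is a matching on $[d]$ (pairwise disjoint pairs) covering all but exactly one coordinate; the uncovered coordinate is the defect coordinate $\delta(b)$. A perfect matching of a finite set is a set of pairwise disjoint two-element subsets covering the whole set; the mate of an element is the other element of its pair. *)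

theory Defs
  imports "HOL-Analysis.Finite_Cartesian_Product" "HOL-Library.Z2"
begin

text \<open>
  The coordinate set [d] is the finite type \<open>'n\<close>, so d is \<open>CARD('n)\<close>, and the vertex set of
  the hypercube is the whole type \<open>bit ^ 'n\<close>, with its coordinatewise addition modulo 2.
\<close>

definition unit_vec :: "'n::finite \<Rightarrow> bit ^ 'n" where
  "unit_vec j = axis j 1"

definition adjacent :: "bit ^ 'n::finite \<Rightarrow> bit ^ 'n \<Rightarrow> bool" where
  "adjacent x y \<longleftrightarrow> card {j. x $ j \<noteq> y $ j} = 1"

definition nbhd :: "bit ^ 'n::finite \<Rightarrow> (bit ^ 'n) set" where
  "nbhd x = {y. adjacent x y}"

definition closed_nbhd :: "bit ^ 'n::finite \<Rightarrow> (bit ^ 'n) set" where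
  "closed_nbhd x = nbhd x \<union> {x}"

definition hamming_weight :: "bit ^ 'n::finite \<Rightarrow> nat" where
  "hamming_weight x = card {j. x $ j \<noteq> 0}"

definition even_class :: "(bit ^ 'n::finite) set" where
  "even_class = {x. even (hamming_weight x)}"

definition odd_class :: "(bit ^ 'n::finite) set" where
  "odd_class = {x. odd (hamming_weight x)}"

definition parity_classes :: "(bit ^ 'n::finite) set \<Rightarrow> (bit ^ 'n) set \<Rightarrow> bool" where
  "parity_classes I D \<longleftrightarrow>
     (I = even_class \<and> D = odd_class) \<or> (I = odd_class \<and> D = even_class)"

definition proper_colouring :: "(bit ^ 'n::finite \<Rightarrow> nat) \<Rightarrow> bool" where
  "proper_colouring c \<longleftrightarrow> (\<forall>x y. adjacent x y \<longrightarrow> c x \<noteq> c y)"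

definition colour_class :: "(bit ^ 'n::finite \<Rightarrow> nat) \<Rightarrow> nat \<Rightarrow> (bit ^ 'n) set" where
  "colour_class c i = {x. c x = i}"

definition pair_defensive ::
    "(bit ^ 'n::finite) set \<Rightarrow> nat \<Rightarrow> (bit ^ 'n \<Rightarrow> nat) \<Rightarrow> bool" where
  "pair_defensive I q c \<longleftrightarrow>
     range c = {1..q} \<and> proper_colouring c \<and>
     (\<forall>i\<in>{1..q}. \<forall>S. S \<subseteq> I \<and> card S \<le> 2 \<longrightarrow>
        (\<exists>f. inj_on f S \<and> f ` S \<subseteq> colour_class c i \<and> (\<forall>x\<in>S. f x \<in> closed_nbhd x)))"

definition extremal_pair_defensive ::
    "(bit ^ 'n::finite) set \<Rightarrow> nat \<Rightarrow> (bit ^ 'n \<Rightarrow> nat) \<Rightarrow> bool" where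
  "extremal_pair_defensive I q c \<longleftrightarrow> pair_defensive I q c \<and> q = (CARD('n) + 3) div 2"

definition perfect_matching :: "'a set set \<Rightarrow> 'a set \<Rightarrow> bool" where
  "perfect_matching M A \<longleftrightarrow>
     (\<forall>p\<in>M. p \<subseteq> A \<and> card p = 2) \<and> pairwise disjnt M \<and> \<Union>M = A"

definition mate :: "'a set set \<Rightarrow> 'a \<Rightarrow> 'a" where
  "mate M j = (THE k. k \<noteq> j \<and> {j, k} \<in> M)"

definition link :: "(bit ^ 'n::finite \<Rightarrow> nat) \<Rightarrow> bit ^ 'n \<Rightarrow> 'n set set" where
  "link c b = {{j, l} | j l. j \<noteq> l \<and> c (b + unit_vec j + unit_vec l) = c b}"

text \<open>
  This is meaningful only if the link of \<open>b\<close> leaves exactly one coordinate uncovered, as it does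
  for every defender vertex of an extremal colouring of odd dimension.
\<close>

definition link_defect :: "(bit ^ 'n::finite \<Rightarrow> nat) \<Rightarrow> bit ^ 'n \<Rightarrow> 'n" where
  "link_defect c b = (THE j. j \<notin> \<Union>(link c b))"

definition \<psi> :: "(bit ^ 'n::finite \<Rightarrow> nat) \<Rightarrow> bit ^ 'n \<Rightarrow> bit ^ 'n" where
  "\<psi> c b = b + unit_vec (link_defect c b)"

text \<open>
  The defect coordinate of an arbitrary vertex; the inverse is that of \<open>\<psi> c\<close> restricted to the
  defender class \<open>D\<close>.
\<close>

definition defect :: "(bit ^ 'n::finite) set \<Rightarrow> (bit ^ 'n \<Rightarrow> nat) \<Rightarrow> bit ^ 'n \<Rightarrow> 'n" where
  "defect D c v = (if v \<in> D then link_defect c v else link_defect c (inv_into D (\<psi> c) v))"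

definition \<Lambda> :: "(bit ^ 'n::finite \<Rightarrow> nat) \<Rightarrow> bit ^ 'n \<Rightarrow> 'n set set" where
  "\<Lambda> c x = {{j, l} | j l. j \<noteq> l \<and> c (x + unit_vec j) = c (x + unit_vec l)}"

text \<open>
  The enlarged coordinate set is \<open>'n option\<close>: a coordinate \<open>j\<close> becomes \<open>Some j\<close>, and the
  auxiliary coordinate * is \<open>None\<close>.
\<close>

definition \<Pi>_plus ::
    "(bit ^ 'n::finite) set \<Rightarrow> (bit ^ 'n \<Rightarrow> nat) \<Rightarrow> bit ^ 'n \<Rightarrow> 'n option set set" where
  "\<Pi>_plus D c v =
     (\<lambda>p. Some ` p) ` (if v \<in> D then link c v else \<Lambda> c v) \<union> {{Some (defect D c v), None}}"

end

theory Submission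
  imports Defs
begin

text \<open>
  Let \<open>x\<close> be an attacked vertex. Defence of \<open>{x}\<close> makes each of the \<open>q - 1\<close> colours other than
  \<open>c x\<close> appear on the \<open>2 * q - 3\<close> neighbours of \<open>x\<close>, and properness excludes \<open>c x\<close> there. As
  \<open>2 * q - 3 < 2 * (q - 1)\<close>, some colour appears on just one neighbour \<open>b\<close> of \<open>x\<close>; call \<open>b\<close> a
  lonely neighbour of \<open>x\<close>, and its direction from \<open>x\<close> a lonely direction. If \<open>b\<close> were
  also a lonely neighbour of another attacked vertex \<open>y\<close>, the pair \<open>{x, y}\<close> could
  not be defended in the colour of \<open>b\<close> (lemma \<open>lonely_inj\<close>). So choosing a lonely neighbour for
  every attacked vertex gives an injection from \<open>I\<close> to \<open>D\<close>. The two classes have the same size,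
  so it is a bijection; since no other lonely neighbour is left over, every attacked vertex has
  exactly one (lemma \<open>lonely_unique\<close>). With only one lonely neighbour the count is tight, and
  every other neighbouring colour appears at \<open>x\<close> exactly twice (lemmas \<open>partner_iff\<close> and
  \<open>partner_unique\<close>). This is the matching \<open>\<Lambda> c x\<close>, with the lonely direction as its uncovered coordinate.

  The links of the defenders need no further counting: the pair \<open>{j, l}\<close> belongs to the link of
  \<open>b\<close> exactly when it belongs to \<open>\<Lambda> c (b + e\<^sub>j)\<close>, because \<open>b\<close> is the neighbour of \<open>b + e\<^sub>j\<close> in
  direction \<open>j\<close> (lemma \<open>link_step\<close>). So direction \<open>j\<close> is uncovered at \<open>b\<close> exactly when \<open>b\<close> is the
  lonely neighbour of \<open>b + e\<^sub>j\<close>, which happens for one \<open>j\<close> by the bijection; hence \<open>\<psi>\<close> is the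
  inverse of the bijection (lemmas \<open>Union_link\<close> and \<open>\<psi>_lonely_nbr\<close>). The
  same equivalence is the compatibility of mates along an edge.
\<close>

section \<open>Matchings\<close>

lemma perfect_matching_of_relation:
  assumes irrefl: "\<And>j l. R j l \<Longrightarrow> j \<noteq> l"
    and sym: "\<And>j l. R j l \<Longrightarrow> R l j"
    and fld: "\<And>j. j \<in> A \<longleftrightarrow> (\<exists>l. R j l)"
    and uniq: "\<And>j l m. R j l \<Longrightarrow> R j m \<Longrightarrow> l = m"
  shows "perfect_matching {{j, l} | j l. R j l} A"
proof -
  have "p \<subseteq> A \<and> card p = 2" if "p \<in> {{j, l} | j l. R j l}" for p
    using that irrefl sym fld by (fastforce simp: card_2_iff)
  moreover have "disjnt p p'"
    if p: "p \<in> {{j, l} | j l. R j l}" and p': "p' \<in> {{j, l} | j l. R j l}" and "p \<noteq> p'" for p p'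
  proof -
    have R: "p = {a, m}" if pR: "p \<in> {{j, l} | j l. R j l}" and a: "a \<in> p" "R a m" for p a m
    proof -
      obtain j l where jl: "p = {j, l}" "R j l" using pR by blast
      then consider "a = j" | "a = l" using a(1) by blast
      then show ?thesis
      proof cases
        case 1
        then show ?thesis using jl uniq[OF a(2)] by blast
      next
        case 2
        then have "j = m" using uniq[OF sym[OF jl(2)]] a(2) by blast
        then show ?thesis using jl(1) 2 by blast
      qed
    qed
    have "p = p'" if "a \<in> p" "a \<in> p'" for a
    proof -
      obtain m where "R a m" using p \<open>a \<in> p\<close> sym by blast
      then have "p = {a, m}" and "p' = {a, m}"
        using R[OF p that(1)] R[OF p' that(2)] by blast+
      then show "p = p'" by simp
    qed
    then show ?thesis using \<open>p \<noteq> p'\<close> unfolding disjnt_iff by blast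
  qed
  moreover have "\<Union>{{j, l} | j l. R j l} = A"
  proof (intro set_eqI iffI)
    fix a assume "a \<in> \<Union>{{j, l} | j l. R j l}"
    then obtain j l where "R j l" "a = j \<or> a = l" by blast
    then show "a \<in> A" using sym[of j l] fld by metis
  next
    fix a assume "a \<in> A"
    then obtain l where "R a l" using fld by blast
    then show "a \<in> \<Union>{{j, l} | j l. R j l}" by blast
  qed
  ultimately show ?thesis
    unfolding perfect_matching_def pairwise_def by blast
qed

lemma mate_eqI:
  assumes "perfect_matching M A" and "{j, k} \<in> M" and "j \<noteq> k"
  shows "mate M j = k"
  unfolding mate_def
proof (rule the_equality)
  show "k \<noteq> j \<and> {j, k} \<in> M" using assms by auto
  fix l assume l: "l \<noteq> j \<and> {j, l} \<in> M"
  have "pairwise disjnt M" using assms(1) unfolding perfect_matching_def by blast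
  moreover have "\<not> disjnt {j, l} {j, k}" unfolding disjnt_iff by blast
  ultimately have "{j, l} = {j, k}"
    using l assms(2) unfolding pairwise_def by metis
  then show "l = k" using l assms(3) by (auto simp: doubleton_eq_iff)
qed

lemma perfect_matching_adjoin_None:
  assumes "perfect_matching M (UNIV - {a})"
  shows "perfect_matching ((\<lambda>p. Some ` p) ` M \<union> {{Some a, None}}) UNIV"
proof -
  have sub: "a \<notin> p" and card: "card p = 2" if "p \<in> M" for p
    using assms that unfolding perfect_matching_def by auto
  have cover: "\<Union>M = UNIV - {a}" and disj: "pairwise disjnt M"
    using assms unfolding perfect_matching_def by auto
  have "card (Some ` p) = 2" if "p \<in> M" for p
    using card[OF that] by (simp add: card_image)
  moreover have "pairwise disjnt ((\<lambda>p. Some ` p) ` M \<union> {{Some a, None}})"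
  proof -
    have "disjnt (Some ` p) (Some ` p')" if "p \<in> M" "p' \<in> M" "Some ` p \<noteq> Some ` p'" for p p'
    proof -
      have "disjnt p p'" using disj that unfolding pairwise_def by blast
      then show ?thesis unfolding disjnt_iff by blast
    qed
    then have "pairwise disjnt ((\<lambda>p. Some ` p) ` M)" unfolding pairwise_def by blast
    moreover have "disjnt (Some ` p) {Some a, None} \<and> disjnt {Some a, None} (Some ` p)"
      if "p \<in> M" for p
      using sub[OF that] unfolding disjnt_iff by auto
    ultimately show ?thesis by (auto simp: pairwise_insert)
  qed
  moreover have "x \<in> \<Union>((\<lambda>p. Some ` p) ` M \<union> {{Some a, None}})" for x
  proof (cases x)
    case (Some j)
    show ?thesis
    proof (cases "j = a")
      case False
      then obtain p where "p \<in> M" "j \<in> p" using cover by blast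
      then show ?thesis using Some by blast
    qed (simp add: Some)
  qed simp
  ultimately show ?thesis
    unfolding perfect_matching_def by auto
qed

section \<open>Surjections with nearly twice as many points as values\<close>

lemma card_eq_sum_fibres:
  assumes "finite A"
  shows "card A = (\<Sum>b\<in>g ` A. card {a \<in> A. g a = b})"
  using sum.image_gen[OF assms, of "\<lambda>_. 1::nat" g] by simp

lemma ex_singleton_fibre:
  assumes "finite A" and "card A < 2 * card (g ` A)"
  shows "\<exists>a\<in>A. \<forall>a'\<in>A. g a' = g a \<longrightarrow> a' = a"
proof (rule ccontr)
  assume no: "\<not> ?thesis"
  have "2 \<le> card {a \<in> A. g a = b}" if b: "b \<in> g ` A" for b
  proof -
    obtain a where a: "a \<in> A" "b = g a" using b by blast
    then obtain a' where "a' \<in> A" "g a' = g a" "a' \<noteq> a" using no by blast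
    then have "{a, a'} \<subseteq> {a \<in> A. g a = b}" "card {a, a'} = 2" using a by auto
    moreover have "finite {a \<in> A. g a = b}" using assms(1) by simp
    ultimately show ?thesis using card_mono by metis
  qed
  then have "2 * card (g ` A) \<le> card A"
    using sum_mono[of "g ` A" "\<lambda>_. 2::nat" "\<lambda>b. card {a \<in> A. g a = b}"]
    by (simp add: card_eq_sum_fibres[OF assms(1), of g] mult.commute)
  then show False using assms(2) by simp
qed

text \<open>
  Every fibre other than \<open>{s}\<close> has at least two points, and the cardinality of \<open>A\<close> leaves room
  for no more than two in each.
\<close>

lemma ex1_other_in_fibre:
  assumes "finite A" and "card A + 1 = 2 * card (g ` A)"
    and "s \<in> A"
    and s: "\<And>a. a \<in> A \<Longrightarrow> (\<forall>a'\<in>A. g a' = g a \<longrightarrow> a' = a) \<longleftrightarrow> a = s"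
    and "a \<in> A" and "a \<noteq> s"
  shows "\<exists>!a'. a' \<in> A \<and> a' \<noteq> a \<and> g a' = g a"
proof -
  define F where "F b = {a \<in> A. g a = b}" for b
  define B where "B = g ` A - {g s}"
  have fin: "finite (F b)" for b using assms(1) unfolding F_def by simp
  have "F (g s) = {s}" using s[OF \<open>s \<in> A\<close>] \<open>s \<in> A\<close> unfolding F_def by auto
  then have one: "card (F (g s)) = 1" by simp
  have two: "2 \<le> card (F b)" if b: "b \<in> B" for b
  proof -
    obtain a where "a \<in> A" "b = g a" "a \<noteq> s" using b unfolding B_def by auto
    moreover obtain a' where "a' \<in> A" "g a' = g a" "a' \<noteq> a"
      using s[of a] calculation by blast
    ultimately have "{a, a'} \<subseteq> F b" "card {a, a'} = 2" unfolding F_def by auto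
    then show ?thesis using card_mono[OF fin] by metis
  qed
  have "card A = card (F (g s)) + (\<Sum>b\<in>B. card (F b))"
    using sum.remove[of "g ` A" "g s" "\<lambda>b. card (F b)"] assms(1,3)
    unfolding B_def by (simp add: card_eq_sum_fibres[OF assms(1), of g] F_def)
  moreover have "card (g ` A) = card B + 1"
    using assms(1,3) card_Suc_Diff1[of "g ` A" "g s"] unfolding B_def by simp
  ultimately have total: "(\<Sum>b\<in>B. card (F b)) = (\<Sum>b\<in>B. 2)"
    using assms(2) one by simp
  have "g a \<in> B"
    using s assms(3,5,6) unfolding B_def by auto
  moreover have "finite B" using assms(1) unfolding B_def by simp
  ultimately have "card (F (g a)) = 2"
    using total two sum_mono_inv[of "\<lambda>_. 2" B "\<lambda>b. card (F b)"] by metis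
  moreover have "a \<in> F (g a)" using assms(5) unfolding F_def by simp
  ultimately obtain a' where "F (g a) = {a, a'}" "a' \<noteq> a"
    unfolding card_2_iff by (metis insertE insert_commute singletonD)
  then have "x \<in> A \<and> g x = g a \<longleftrightarrow> x = a \<or> x = a'" for x
    unfolding F_def by (auto simp: set_eq_iff)
  then show ?thesis using \<open>a' \<noteq> a\<close> by metis
qed

section \<open>Directions in the hypercube\<close>

lemma finite_cube: "finite (A :: (bit ^ 'n::finite) set)"
proof -
  have "inj (\<lambda>v :: bit ^ 'n. {j. v $ j = 0})"
  proof (rule injI)
    fix v w :: "bit ^ 'n" assume "{j. v $ j = 0} = {j. w $ j = 0}"
    then have "v $ j = 0 \<longleftrightarrow> w $ j = 0" for j by (simp add: set_eq_iff)
    then show "v = w" by (metis bit_not_zero_iff vec_eq_iff)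
  qed
  then have "inj_on (\<lambda>v. {j. v $ j = 0}) A" by (rule inj_on_subset) simp
  then show ?thesis by (rule inj_on_finite[where B = UNIV]) simp_all
qed

lemma unit_vec_nth: "unit_vec j $ k = (if k = j then 1 else 0)"
  by (simp add: unit_vec_def axis_def)

lemma add_unit_vec_twice [simp]: "x + unit_vec j + unit_vec j = x"
  by (simp add: vec_eq_iff unit_vec_nth)

lemma adjacent_iff: "adjacent x y \<longleftrightarrow> (\<exists>j. y = x + unit_vec j)"
proof
  assume "adjacent x y"
  then obtain j where j: "{k. x $ k \<noteq> y $ k} = {j}"
    unfolding adjacent_def by (auto simp: card_1_singleton_iff)
  have "y $ k = (x + unit_vec j) $ k" for k
  proof (cases "k = j")
    case True
    then have "x $ k \<noteq> y $ k" using j by blast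
    then show ?thesis using True by (cases "x $ k"; cases "y $ k") (auto simp: unit_vec_nth)
  next
    case False
    then have "x $ k = y $ k" using j by blast
    then show ?thesis using False by (simp add: unit_vec_nth)
  qed
  then show "\<exists>j. y = x + unit_vec j" by (auto simp: vec_eq_iff)
next
  assume "\<exists>j. y = x + unit_vec j"
  then obtain j where "y = x + unit_vec j" ..
  then have "{k. x $ k \<noteq> y $ k} = {j}" by (auto simp: unit_vec_nth)
  then show "adjacent x y" unfolding adjacent_def by simp
qed

lemma even_hamming_weight_add_unit_vec:
  "even (hamming_weight (x + unit_vec j)) \<longleftrightarrow> odd (hamming_weight x)"
proof (cases "x $ j = 0")
  case True
  then have "{k. (x + unit_vec j) $ k \<noteq> 0} = insert j {k. x $ k \<noteq> 0}"
    by (auto simp: unit_vec_nth)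
  then show ?thesis using True by (simp add: hamming_weight_def)
next
  case False
  then have "{k. x $ k \<noteq> 0} = insert j {k. (x + unit_vec j) $ k \<noteq> 0}"
    by (auto simp: unit_vec_nth)
  then have "hamming_weight x = Suc (hamming_weight (x + unit_vec j))"
    using False by (simp add: hamming_weight_def unit_vec_nth)
  then show ?thesis by simp
qed

section \<open>Extremal pair-defensive colourings\<close>

locale extremal_colouring =
  fixes q :: nat and I D :: "(bit ^ 'n::finite) set" and c :: "bit ^ 'n \<Rightarrow> nat"
  assumes q2: "q \<ge> 2"
    and dim: "CARD('n) = 2 * q - 3"
    and parity: "parity_classes I D"
    and defensive: "pair_defensive I q c"
begin

lemma D_iff: "v \<in> D \<longleftrightarrow> v \<notin> I"
  using parity unfolding parity_classes_def even_class_def odd_class_def by auto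

lemma step_in_I_iff: "v + unit_vec j \<in> I \<longleftrightarrow> v \<notin> I"
  using parity even_hamming_weight_add_unit_vec
  unfolding parity_classes_def even_class_def odd_class_def by auto

lemma step_colour_neq: "c (x + unit_vec j) \<noteq> c x"
  using defensive adjacent_iff unfolding pair_defensive_def proper_colouring_def by metis

lemma closed_nbhd_iff: "y \<in> closed_nbhd x \<longleftrightarrow> y = x \<or> (\<exists>j. y = x + unit_vec j)"
  unfolding closed_nbhd_def nbhd_def using adjacent_iff by auto

lemma colour_in: "c v \<in> {1..q}"
  using defensive unfolding pair_defensive_def by (metis rangeI)

lemma defended:
  assumes "i \<in> {1..q}" and "S \<subseteq> I" and "card S \<le> 2"
  obtains f where "inj_on f S" and "\<And>x. x \<in> S \<Longrightarrow> c (f x) = i"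
    and "\<And>x. x \<in> S \<Longrightarrow> f x \<in> closed_nbhd x"
proof -
  have "\<exists>f. inj_on f S \<and> f ` S \<subseteq> colour_class c i \<and> (\<forall>x\<in>S. f x \<in> closed_nbhd x)"
    using defensive assms unfolding pair_defensive_def by simp
  then obtain f where f: "inj_on f S" "f ` S \<subseteq> colour_class c i" "\<forall>x\<in>S. f x \<in> closed_nbhd x"
    by auto
  then have "c (f x) = i" if "x \<in> S" for x
    using that unfolding colour_class_def by auto
  then show thesis using f that by simp
qed

lemma neighbour_colours:
  assumes "x \<in> I"
  shows "range (\<lambda>j. c (x + unit_vec j)) = {1..q} - {c x}"
proof
  show "range (\<lambda>j. c (x + unit_vec j)) \<subseteq> {1..q} - {c x}"
    using step_colour_neq colour_in by (metis Diff_iff image_subsetI singletonD)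
  show "{1..q} - {c x} \<subseteq> range (\<lambda>j. c (x + unit_vec j))"
  proof
    fix i assume i: "i \<in> {1..q} - {c x}"
    obtain f where "c (f x) = i" "f x \<in> closed_nbhd x"
      using defended[of i "{x}"] i assms by auto
    then show "i \<in> range (\<lambda>j. c (x + unit_vec j))"
      using i closed_nbhd_iff[of "f x" x] by auto
  qed
qed

lemma card_neighbour_colours:
  assumes "x \<in> I"
  shows "CARD('n) + 1 = 2 * card (range (\<lambda>j. c (x + unit_vec j)))"
proof -
  have "card ({1..q} - {c x}) = q - 1" using colour_in[of x] by simp
  then show ?thesis using neighbour_colours[OF assms] dim q2 by simp
qed

definition lonely :: "bit ^ 'n \<Rightarrow> 'n \<Rightarrow> bool" where
  "lonely x j \<longleftrightarrow> (\<forall>l. c (x + unit_vec l) = c (x + unit_vec j) \<longrightarrow> l = j)"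

definition partner :: "bit ^ 'n \<Rightarrow> 'n \<Rightarrow> 'n \<Rightarrow> bool" where
  "partner x j l \<longleftrightarrow> j \<noteq> l \<and> c (x + unit_vec j) = c (x + unit_vec l)"

definition lonely_dir :: "bit ^ 'n \<Rightarrow> 'n" where
  "lonely_dir x = (SOME j. lonely x j)"

lemma lonely_lonely_dir:
  assumes "x \<in> I"
  shows "lonely x (lonely_dir x)"
proof -
  have "\<exists>j. lonely x j"
    using ex_singleton_fibre[of UNIV "\<lambda>j. c (x + unit_vec j)"] card_neighbour_colours[OF assms]
    unfolding lonely_def by auto
  then show ?thesis unfolding lonely_dir_def by (rule someI_ex)
qed

text \<open>
  Call the common neighbour \<open>b\<close>. Neither \<open>x\<close> nor \<open>y\<close> has the colour of \<open>b\<close>, the colouring being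
  proper, so only \<open>b\<close> can defend either of them in that colour; but \<open>b\<close> cannot defend two distinct
  vertices at once.
\<close>

lemma lonely_inj:
  assumes "x \<in> I" and "y \<in> I" and "lonely x j" and "lonely y l"
    and eq: "x + unit_vec j = y + unit_vec l"
  shows "x = y"
proof -
  define b where "b = x + unit_vec j"
  have "card {x, y} \<le> 2" by (simp add: card_insert_if)
  then obtain f where f: "inj_on f {x, y}" "\<And>z. z \<in> {x, y} \<Longrightarrow> c (f z) = c b"
      "\<And>z. z \<in> {x, y} \<Longrightarrow> f z \<in> closed_nbhd z"
    using defended[of "c b" "{x, y}"] colour_in assms(1,2) by auto
  have forced: "f z = b" if "z \<in> {x, y}" "lonely z m" "b = z + unit_vec m" for z m
  proof -
    have "c (f z) = c b" "f z \<in> closed_nbhd z"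
      using f(2,3) that(1) by auto
    then show ?thesis
      using that(2,3) step_colour_neq[of z m] closed_nbhd_iff[of "f z" z]
      unfolding lonely_def by metis
  qed
  have "f x = b" by (rule forced[OF _ assms(3) b_def]) simp
  moreover have "f y = b" by (rule forced[OF _ assms(4) b_def[unfolded eq]]) simp
  ultimately have "f x = f y" by (rule trans[OF _ sym])
  then show "x = y" by (rule inj_onD[OF f(1)]) simp_all
qed

definition lonely_nbr :: "bit ^ 'n \<Rightarrow> bit ^ 'n" where
  "lonely_nbr x = x + unit_vec (lonely_dir x)"

lemma bij_lonely_nbr: "bij_betw lonely_nbr I D"
proof -
  have inj: "inj_on lonely_nbr I"
    unfolding lonely_nbr_def
    by (rule inj_onI) (rule lonely_inj[OF _ _ lonely_lonely_dir lonely_lonely_dir])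
  have sub: "lonely_nbr ` I \<subseteq> D"
    unfolding lonely_nbr_def using D_iff step_in_I_iff by auto
  \<comment> \<open>Flipping any fixed coordinate exchanges the two classes, so they have the same size.\<close>
  have "inj_on (\<lambda>v. v + unit_vec undefined) D" by (auto simp: inj_on_def)
  moreover have "(\<lambda>v. v + unit_vec undefined) ` D \<subseteq> I"
    using D_iff step_in_I_iff by auto
  ultimately have "card D \<le> card I" by (rule card_inj_on_le) (rule finite_cube)
  then have "lonely_nbr ` I = D"
    using card_seteq[OF finite_cube sub] card_image[OF inj] by simp
  then show ?thesis using inj by (simp add: bij_betw_def)
qed

text \<open>
  The neighbour \<open>x + e\<^sub>j\<close> in a lonely direction is already the chosen lonely neighbour of some
  attacked vertex, and by \<open>lonely_inj\<close> that vertex can only be \<open>x\<close>.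
\<close>

lemma lonely_unique:
  assumes "x \<in> I"
  shows "lonely x j \<longleftrightarrow> j = lonely_dir x"
proof
  assume j: "lonely x j"
  have "x + unit_vec j \<in> D" using assms D_iff step_in_I_iff by simp
  then obtain y where y: "y \<in> I" "x + unit_vec j = lonely_nbr y"
    using bij_lonely_nbr unfolding bij_betw_def by blast
  then have "x = y"
    using lonely_inj[OF assms y(1) j lonely_lonely_dir] unfolding lonely_nbr_def by simp
  then show "j = lonely_dir x"
    using y(2) j unfolding lonely_nbr_def lonely_def by metis
qed (simp add: lonely_lonely_dir assms)

lemma partner_sym: "partner x j l \<Longrightarrow> partner x l j"
  unfolding partner_def by auto

lemma partner_iff:
  assumes "x \<in> I"
  shows "(\<exists>l. partner x j l) \<longleftrightarrow> j \<noteq> lonely_dir x"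
  using lonely_unique[OF assms, of j] unfolding lonely_def partner_def by metis

lemma partner_unique:
  assumes "x \<in> I" and "partner x j l" and "partner x j m"
  shows "l = m"
proof -
  have "j \<noteq> lonely_dir x" using partner_iff assms(1,2) by blast
  then have "\<exists>!l. l \<in> UNIV \<and> l \<noteq> j \<and> c (x + unit_vec l) = c (x + unit_vec j)"
    using card_neighbour_colours[OF assms(1)] lonely_unique[OF assms(1)]
    by (intro ex1_other_in_fibre[where s = "lonely_dir x"]) (auto simp: lonely_def)
  then show ?thesis using assms(2,3) unfolding partner_def by (metis UNIV_I)
qed

lemma \<Lambda>_eq: "\<Lambda> c x = {{j, l} | j l. partner x j l}"
  unfolding \<Lambda>_def partner_def ..

lemma perfect_matching_\<Lambda>:
  assumes "x \<in> I"
  shows "perfect_matching (\<Lambda> c x) (UNIV - {lonely_dir x})"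
  unfolding \<Lambda>_eq
proof (rule perfect_matching_of_relation)
  show "j \<in> UNIV - {lonely_dir x} \<longleftrightarrow> (\<exists>l. partner x j l)" for j
    using partner_iff[OF assms] by simp
  show "partner x j l \<Longrightarrow> j \<noteq> l" for j l by (simp add: partner_def)
qed (fact partner_sym, fact partner_unique[OF assms])

section \<open>Links of defender vertices\<close>

text \<open>
  The vertex \<open>b\<close> is itself the neighbour of \<open>b + e\<^sub>j\<close> in direction \<open>j\<close>.
\<close>

lemma link_step: "j \<noteq> l \<and> c (b + unit_vec j + unit_vec l) = c b \<longleftrightarrow> partner (b + unit_vec j) j l"
  unfolding partner_def by auto

lemma link_eq: "link c b = {{j, l} | j l. partner (b + unit_vec j) j l}"
  unfolding link_def link_step ..

lemma partner_step_sym: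
  "partner (b + unit_vec j) j l \<Longrightarrow> partner (b + unit_vec l) l j"
  unfolding link_step[symmetric] by (auto simp: ac_simps)

text \<open>
  Let \<open>b\<close> be the lonely neighbour of \<open>x\<close>. If direction \<open>j\<close> is uncovered at \<open>b\<close>, it is the lonely
  direction of \<open>b + e\<^sub>j\<close>, so \<open>b\<close> is the lonely neighbour of \<open>b + e\<^sub>j\<close> too. Injectivity forces
  \<open>b + e\<^sub>j = x\<close>.
\<close>

lemma Union_link:
  assumes "x \<in> I"
  shows "\<Union>(link c (lonely_nbr x)) = UNIV - {lonely_dir x}"
proof -
  let ?b = "lonely_nbr x"
  have b: "?b \<in> D" using bij_lonely_nbr assms unfolding bij_betw_def by blast
  have "\<Union>(link c ?b) = {j. \<exists>l. partner (?b + unit_vec j) j l}"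
    unfolding link_eq using partner_step_sym by blast
  moreover have "(\<exists>l. partner (?b + unit_vec j) j l) \<longleftrightarrow> j \<noteq> lonely_dir x" for j
  proof -
    have y: "?b + unit_vec j \<in> I" using b D_iff step_in_I_iff by simp
    have "j = lonely_dir (?b + unit_vec j) \<longleftrightarrow> j = lonely_dir x"
    proof
      assume "j = lonely_dir (?b + unit_vec j)"
      then have "lonely_nbr (?b + unit_vec j) = ?b"
        unfolding lonely_nbr_def[of "?b + unit_vec j"] by (metis add_unit_vec_twice)
      then have "?b + unit_vec j = x"
        using bij_lonely_nbr y assms unfolding bij_betw_def inj_on_def by blast
      then show "j = lonely_dir x" using \<open>j = lonely_dir (?b + unit_vec j)\<close> by simp
    next
      assume "j = lonely_dir x"
      then show "j = lonely_dir (?b + unit_vec j)" unfolding lonely_nbr_def by simp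
    qed
    then show ?thesis using partner_iff[OF y] by simp
  qed
  ultimately show ?thesis by auto
qed

lemma link_defect_lonely_nbr:
  assumes "x \<in> I"
  shows "link_defect c (lonely_nbr x) = lonely_dir x"
  unfolding link_defect_def Union_link[OF assms] by auto

lemma perfect_matching_link:
  assumes "b \<in> D"
  shows "perfect_matching (link c b) (UNIV - {link_defect c b})"
proof -
  obtain x where x: "x \<in> I" "b = lonely_nbr x"
    using bij_lonely_nbr assms unfolding bij_betw_def by blast
  have "\<Union>(link c b) = UNIV - {link_defect c b}"
    using Union_link link_defect_lonely_nbr x by simp
  moreover have "\<Union>(link c b) = {j. \<exists>l. partner (b + unit_vec j) j l}"
    unfolding link_eq using partner_step_sym by blast
  ultimately have cover: "j \<in> UNIV - {link_defect c b} \<longleftrightarrow> (\<exists>l. partner (b + unit_vec j) j l)" for j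
    by blast
  have I: "b + unit_vec j \<in> I" for j using assms D_iff step_in_I_iff by simp
  show ?thesis
    unfolding link_eq
  proof (rule perfect_matching_of_relation)
    show "partner (b + unit_vec j) j l \<Longrightarrow> j \<noteq> l" for j l by (simp add: partner_def)
  qed (fact partner_step_sym, fact cover, fact partner_unique[OF I])
qed

lemma \<psi>_lonely_nbr:
  assumes "x \<in> I"
  shows "\<psi> c (lonely_nbr x) = x"
  using link_defect_lonely_nbr[OF assms] by (simp add: \<psi>_def lonely_nbr_def)

lemma lonely_nbr_\<psi>:
  assumes "b \<in> D"
  shows "lonely_nbr (\<psi> c b) = b"
  using assms bij_lonely_nbr \<psi>_lonely_nbr unfolding bij_betw_def by force

lemma bij_\<psi>: "bij_betw (\<psi> c) D I"
proof -
  have "lonely_nbr x \<in> D" if "x \<in> I" for x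
    using bij_lonely_nbr that unfolding bij_betw_def by blast
  moreover have "\<psi> c b \<in> I" if "b \<in> D" for b
    using that D_iff step_in_I_iff unfolding \<psi>_def by simp
  ultimately show ?thesis
    by (intro bij_betwI[where g = lonely_nbr]) (auto simp: \<psi>_lonely_nbr lonely_nbr_\<psi>)
qed

lemma perfect_matching_defect_edges: "perfect_matching {{b, \<psi> c b} | b. b \<in> D} (D \<union> I)"
proof -
  let ?R = "\<lambda>u v. u \<in> D \<and> v = \<psi> c u \<or> v \<in> D \<and> u = \<psi> c v"
  have to_I: "\<psi> c b \<in> I" if "b \<in> D" for b
    using bij_\<psi> that unfolding bij_betw_def by blast
  have "{{b, \<psi> c b} | b. b \<in> D} = {{u, v} | u v. ?R u v}"
    by (auto simp: insert_commute)
  moreover have "perfect_matching {{u, v} | u v. ?R u v} (D \<union> I)"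
  proof (rule perfect_matching_of_relation)
    show "u \<in> D \<union> I \<longleftrightarrow> (\<exists>v. ?R u v)" for u
      using bij_\<psi> unfolding bij_betw_def by blast
    show "v = w" if "?R u v" "?R u w" for u v w
      using that to_I D_iff lonely_nbr_\<psi> by metis
    show "u \<noteq> v" if "?R u v" for u v
      using that to_I D_iff by metis
  qed auto
  ultimately show ?thesis by simp
qed

section \<open>The enlarged matchings\<close>

lemma defect_I:
  assumes "x \<in> I"
  shows "defect D c x = lonely_dir x"
proof -
  have "lonely_nbr x \<in> D" using bij_lonely_nbr assms unfolding bij_betw_def by blast
  then have "inv_into D (\<psi> c) x = lonely_nbr x"
    using bij_\<psi> \<psi>_lonely_nbr[OF assms] inv_into_f_f[of "\<psi> c" D "lonely_nbr x"]
    unfolding bij_betw_def by simp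
  then show ?thesis using assms D_iff link_defect_lonely_nbr unfolding defect_def by simp
qed

lemma perfect_matching_\<Pi>_plus: "perfect_matching (\<Pi>_plus D c v) UNIV"
proof (cases "v \<in> D")
  case True
  then show ?thesis
    using perfect_matching_adjoin_None[OF perfect_matching_link] by (simp add: \<Pi>_plus_def defect_def)
next
  case False
  then show ?thesis
    using perfect_matching_adjoin_None[OF perfect_matching_\<Lambda>] D_iff defect_I
    by (simp add: \<Pi>_plus_def)
qed

text \<open>
  For the attacked end \<open>x\<close> of the edge, either the edge is a defect edge and both mates of \<open>j\<close> are
  the auxiliary coordinate, or \<open>link_step\<close> gives \<open>j\<close> the same mate at both ends.
\<close>

lemma mate_\<Pi>_plus_step_D:
  assumes "b \<in> D"
  shows "mate (\<Pi>_plus D c (b + unit_vec j)) (Some j) = mate (\<Pi>_plus D c b) (Some j)"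
proof -
  define x where "x = b + unit_vec j"
  have b: "b = x + unit_vec j" unfolding x_def by simp
  have x: "x \<in> I" "x \<notin> D" using assms D_iff step_in_I_iff unfolding x_def by auto
  have "\<exists>k. {Some j, k} \<in> \<Pi>_plus D c x \<and> {Some j, k} \<in> \<Pi>_plus D c b \<and> Some j \<noteq> k"
  proof (cases "j = lonely_dir x")
    case True
    then have "defect D c b = j"
      using assms link_defect_lonely_nbr[OF x(1)] unfolding b lonely_nbr_def defect_def by simp
    then show ?thesis
      using True defect_I[OF x(1)] unfolding \<Pi>_plus_def by auto
  next
    case False
    then obtain l where l: "partner x j l" using partner_iff[OF x(1)] by blast
    have "{j, l} \<in> \<Lambda> c x"
      unfolding \<Lambda>_eq using l by blast
    moreover have "{j, l} \<in> link c b"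
      unfolding link_eq using l unfolding x_def by blast
    moreover have "{Some j, Some l} = Some ` {j, l}" by simp
    ultimately have "{Some j, Some l} \<in> \<Pi>_plus D c x" "{Some j, Some l} \<in> \<Pi>_plus D c b"
      using assms x(2) unfolding \<Pi>_plus_def by (metis UnI1 image_eqI)+
    then show ?thesis using l unfolding partner_def by auto
  qed
  then show ?thesis
    using mate_eqI[OF perfect_matching_\<Pi>_plus] unfolding x_def by metis
qed

lemma mate_\<Pi>_plus_step:
  "mate (\<Pi>_plus D c (v + unit_vec j)) (Some j) = mate (\<Pi>_plus D c v) (Some j)"
proof (cases "v \<in> D")
  case False
  then have "v + unit_vec j \<in> D" using D_iff step_in_I_iff by simp
  then show ?thesis using mate_\<Pi>_plus_step_D[of "v + unit_vec j" j] by simp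
qed (rule mate_\<Pi>_plus_step_D)

end

theorem proposition5p2:
  fixes q :: nat
    and I D :: "(bit ^ 'n::finite) set"
    and c :: "bit ^ 'n \<Rightarrow> nat"
  assumes "q \<ge> 2"
    and "CARD('n) = 2 * q - 3"
    and "parity_classes I D"
    and "extremal_pair_defensive I q c"
  shows
    "(bij_betw (\<psi> c) D I \<and>
      (\<forall>b\<in>D. adjacent b (\<psi> c b)) \<and>
      perfect_matching {{b, \<psi> c b} | b. b \<in> D} (D \<union> I)) \<and>
     (\<forall>x\<in>I. perfect_matching (\<Lambda> c x) (UNIV - {defect D c x})) \<and>
     (\<forall>v. perfect_matching (\<Pi>_plus D c v) (UNIV :: 'n option set)) \<and>
     (\<forall>v j. mate (\<Pi>_plus D c (v + unit_vec j)) (Some j) = mate (\<Pi>_plus D c v) (Some j))"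
proof -
  have "pair_defensive I q c"
    using assms(4) unfolding extremal_pair_defensive_def by blast
  then interpret extremal_colouring q I D c
    by (rule extremal_colouring.intro[OF assms(1-3)])
  have "adjacent b (\<psi> c b)" for b
    unfolding \<psi>_def using adjacent_iff by blast
  moreover have "perfect_matching (\<Lambda> c x) (UNIV - {defect D c x})" if "x \<in> I" for x
    unfolding defect_I[OF that] by (rule perfect_matching_\<Lambda>[OF that])
  ultimately show ?thesis
    by (intro conjI allI ballI bij_\<psi> perfect_matching_defect_edges perfect_matching_\<Pi>_plus
        mate_\<Pi>_plus_step)
qed

end
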